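(* Consider a single (possibly nonconforming) interface between two SBP blocks, a minus block and a plus block. For each side, let $\mathbf{p}^{\pm},\mathbf{v}^{\pm}$ be the pressure and the (outward) normal velocity grid values along the interface edge, $\mathbf{H}^{\pm}$ the 1-D SBP norm matrix along that edge (diagonal, positive definite), and $\mathbf{S}_J^{\pm}$ the positive diagonal surface Jacobian matrix along that edge. Let $\mathbf{M}$ be the symmetric positive definite glue-grid mass matrix and let $\mathbf{P}_{f2g}^{\pm},\mathbf{P}_{g2f}^{\pm}$ be $\mathbf{H}^{\pm}$-compatible projection matrices, i.e. $(\mathbf{P}_{g2f}^{\pm})^{T}\mathbf{H}^{\pm}=\mathbf{M}\mathbf{P}_{f2g}^{\pm}$. Set $$\bar{\mathbf{p}}^{\pm}=\mathbf{P}_{f2g}^{\pm}(\mathbf{S}_J^{\pm})^{1/2}\mathbf{p}^{\pm},\qquad \bar{\mathbf{v}}^{\pm}=\mathbf{P}_{f2g}^{\pm}(\mathbf{S}_J^{\pm})^{1/2}\mathbf{v}^{\pm}.$$ Suppose that on the minus side the values $\mathbf{p}^*,\mathbf{v}^*$ are given by $$\mathbf{p}^{*}-\mathbf{p}^{-}=(\mathbf{S}_J^{-})^{-1/2}\mathbf{P}_{g2f}^{-}(\bar{\mathbf{p}}^{*}-\bar{\mathbf{p}}^{-})+\tfrac12\left[(\mathbf{S}_J^{-})^{-1/2}\mathbf{P}_{g2f}^{-}\bar{\mathbf{p}}^{-}-\mathbf{p}^{-}\right],$$ $$\mathbf{v}^{*}-\mathbf{v}^{-}=(\mathbf{S}_J^{-})^{-1/2}\mathbf{P}_{g2f}^{-}(\bar{\mathbf{v}}^{*}-\bar{\mathbf{v}}^{-})+\tfrac12\left[(\mathbf{S}_J^{-})^{-1/2}\mathbf{P}_{g2f}^{-}\bar{\mathbf{v}}^{-}-\mathbf{v}^{-}\right],$$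 where $$\bar{\mathbf{p}}^{*}-\bar{\mathbf{p}}^{-}=\tfrac12(\bar{\mathbf{p}}^{+}-\bar{\mathbf{p}}^{-})+\alpha\tfrac{Z}{2}(\bar{\mathbf{v}}^{+}+\bar{\mathbf{v}}^{-}),\qquad \bar{\mathbf{v}}^{*}-\bar{\mathbf{v}}^{-}=-\tfrac12(\bar{\mathbf{v}}^{+}+\bar{\mathbf{v}}^{-})-\alpha\tfrac{1}{2Z}(\bar{\mathbf{p}}^{+}-\bar{\mathbf{p}}^{-}),$$ and that on the plus side they are given by the same formulas with the roles of $+$ and $-$ interchanged. Here $\alpha$ is a real parameter and $Z=\sqrt{\rho/\lambda}>0$. Let $\mathcal{D}^{-}$ and $\mathcal{D}^{+}$ be the energy dissipation rates along the two sides of the interface. Then $$\mathcal{D}^{-}+\mathcal{D}^{+}=-\alpha\frac{Z}{2}(\bar{\mathbf{v}}^{-}+\bar{\mathbf{v}}^{+})^{T}\mathbf{M}(\bar{\mathbf{v}}^{-}+\bar{\mathbf{v}}^{+})-\alpha\frac{1}{2Z}(\bar{\mathbf{p}}^{-}-\bar{\mathbf{p}}^{+})^{T}\mathbf{M}(\bar{\mathbf{p}}^{-}-\bar{\mathbf{p}}^{+}),$$ which is non-positive for $\alpha\ge 0$.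
   Context: Model problem: $\rho\,\partial_t v_i+\partial p/\partial x_i=0$ ($i=1,2$), $\partial_t p+\lambda(\partial v_1/\partial x_1+\partial v_2/\partial x_2)=0$ with constants $\rho,\lambda>0$. SBP block: a quadrilateral block is the image of $[-1,1]^2$ under an invertible coordinate transform $x_i=x_i(\xi_1,\xi_2)$ with Jacobian determinant $J>0$. The block carries the $(N_1+1)\times(N_2+1)$ equispaced grid in $[-1,1]^2$; time-dependent grid functions $\mathbf{v}_1,\mathbf{v}_2,\mathbf{p}\in\mathbb{R}^{(N_1+1)(N_2+1)}$ are ordered with the $\xi_2$-index running fastest. $\mathbf{J}$ and $\mathbf{X}_{ij}$ are the diagonal matrices of grid values of $J$ and $\partial\xi_i/\partial x_j$. The 1-D SBP operators are $\mathbf{D}_{N_i}=\mathbf{H}_{N_i}^{-1}\mathbf{Q}_{N_i}$ with $\mathbf{H}_{N_i}$ diagonal positive definite and $\mathbf{Q}_{N_i}+\mathbf{Q}_{N_i}^T=\mathrm{diag}(-1,0,\dots,0,1)$. Put $\mathbf{H}=\mathbf{H}_{N_1}\otimes\mathbf{H}_{N_2}$, $\mathbf{D}_1=\mathbf{D}_{N_1}\otimes\mathbf{I}$, $\mathbf{D}_2=\mathbf{I}\otimes\mathbf{D}_{N_2}$. The semi-discretization on a block is $$\rho\mathbf{J}\frac{d\mathbf{v}_i}{dt}+\mathbf{D}_1\mathbf{J}\mathbf{X}_{1i}\mathbf{p}+\mathbf{D}_2\mathbf{J}\mathbf{X}_{2i}\mathbf{p}=-\mathbf{H}^{-1}\boldsymbol{\mathcal{F}}_{v_i}\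 (i=1,2),\qquad \mathbf{J}\frac{d\mathbf{p}}{dt}+\lambda\sum_{i,j=1}^2\mathbf{J}\mathbf{X}_{ij}\mathbf{D}_i\mathbf{v}_j=-\lambda\mathbf{H}^{-1}\boldsymbol{\mathcal{F}}_p .$$ The edges $K\in\{W,E,S,N\}$ are $\xi_1=-1$, $\xi_1=1$, $\xi_2=-1$, $\xi_2=1$. On the edge $\xi_a=\pm1$, $S_J=J\sqrt{(\partial\xi_a/\partial x_1)^2+(\partial\xi_a/\partial x_2)^2}$ is the surface Jacobian and $n_i=\pm(J/S_J)\,\partial\xi_a/\partial x_i$ are the components of the outward unit normal; $\mathbf{S}_{JK}$, $\mathbf{n}_i^K$ are the diagonal matrices of their values at the grid points of edge $K$. $\mathbf{p}_K$ is the restriction of $\mathbf{p}$ to edge $K$ and $\mathbf{v}_K=\mathbf{n}^K_1\mathbf{v}_{1}|_K+\mathbf{n}^K_2\mathbf{v}_2|_K$. $\mathbf{H}_W=\mathbf{H}_E=\mathbf{H}_{N_2}$, $\mathbf{H}_S=\mathbf{H}_N=\mathbf{H}_{N_1}$. The penalty terms are $\boldsymbol{\mathcal F}_{\bullet}=\mathbf{e}_W\otimes\boldsymbol{\mathcal F}^W_\bullet+\mathbf{e}_E\otimes\boldsymbol{\mathcal F}^E_\bullet+\boldsymbol{\mathcal F}^S_\bullet\otimes\mathbf{e}_S+\boldsymbol{\mathcal F}^N_\bullet\otimes\mathbf{e}_N$ with $\boldsymbol{\mathcal F}^K_{v_i}=\mathbf{H}_K\mathbf{S}_{JK}\mathbf{n}_i^K(\mathbf{p}^*_K-\mathbf{p}_K)$,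 $\boldsymbol{\mathcal F}^K_{p}=\mathbf{H}_K\mathbf{S}_{JK}(\mathbf{v}^*_K-\mathbf{v}_K)$, where $\mathbf{e}_W,\mathbf{e}_S$ are first and $\mathbf{e}_E,\mathbf{e}_N$ last standard basis vectors, and $\mathbf{p}^*_K,\mathbf{v}^*_K$ are vectors prescribed by the boundary or interface treatment. The block energy is $E=\frac{\rho}{2}\mathbf{v}_1^T\mathbf{J}\mathbf{H}\mathbf{v}_1+\frac{\rho}{2}\mathbf{v}_2^T\mathbf{J}\mathbf{H}\mathbf{v}_2+\frac{1}{2\lambda}\mathbf{p}^T\mathbf{J}\mathbf{H}\mathbf{p}$. Energy dissipation rate along edge $K$ (the contribution of that edge to $dE/dt$): $$\mathcal{D}_K=-\mathbf{v}_K^T\mathbf{H}_K\mathbf{S}_{JK}\mathbf{p}_K^*+\mathbf{v}_K^T\mathbf{H}_K\mathbf{S}_{JK}\mathbf{p}_K-(\mathbf{v}_K^* )^T\mathbf{H}_K\mathbf{S}_{JK}\mathbf{p}_K.$$ $\mathcal{D}^{\pm}$ denotes this quantity for the interface edge of the plus/minus block (each with its own $\mathbf{p}^*,\mathbf{v}^*$). Glue grid: a finite-dimensional space of functions in $L^2$ of the interface with linearly independent basis $\boldsymbol\psi(\eta)$ and mass matrix $\mathbf{M}=\int\boldsymbol\psi\boldsymbol\psi^T d\eta$; barred vectors are coefficient vectors in this basis. Both blocks have the same continuous coordinate transform along the interface, but may have different grids and SBP operators, so $\mathbf{H}^\pm$, $\mathbf{S}_J^\pm$ may differ in size and values. No assumption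 that $\mathbf{P}_{g2f}^\pm\mathbf{P}_{f2g}^\pm=\mathbf{I}$ is made. *)

theory Defs
  imports "HOL-Analysis.Analysis" "Jordan_Normal_Form.Matrix"
begin

text \<open>
  Grid sizes vary from block to block, so grid functions and grid matrices are of type
  \<^typ>\<open>real Matrix.vec\<close> and \<^typ>\<open>real Matrix.mat\<close>; \<open>$\<close> below always selects a component of a
  \<^typ>\<open>real ^ 2\<close> or \<^typ>\<open>real ^ 2 ^ 2\<close>, and \<open>\<bullet>\<close> is \<open>scalar_prod\<close>.
\<close>

no_notation vec_index (infixl \<open>$\<close> 100)
no_notation inner (infix \<open>\<bullet>\<close> 70)

definition positive_definite_mat :: "real mat \<Rightarrow> bool" where
  "positive_definite_mat A \<longleftrightarrow>
     (\<forall>x \<in> carrier_vec (dim_row A). x \<noteq> 0\<^sub>v (dim_row A) \<longrightarrow> 0 < x \<bullet> (A *\<^sub>v x))"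

definition diag_mat_powr :: "real mat \<Rightarrow> real \<Rightarrow> real mat" where
  "diag_mat_powr S r = mat_diag (dim_row S) (\<lambda>k. (S $$ (k, k)) powr r)"


section \<open>One-dimensional summation-by-parts operators\<close>

text \<open>The difference operator is \<open>H\<^sup>-\<^sup>1 Q\<close>; it is represented by the pair \<open>H\<close>, \<open>Q\<close>.\<close>

definition sbp_operator :: "nat \<Rightarrow> real mat \<Rightarrow> real mat \<Rightarrow> bool" where
  "sbp_operator N H Q \<longleftrightarrow>
     1 \<le> N \<and>
     H \<in> carrier_mat (N + 1) (N + 1) \<and> diagonal_mat H \<and> positive_definite_mat H \<and>
     Q \<in> carrier_mat (N + 1) (N + 1) \<and>
     Q + transpose_mat Q = mat_diag (N + 1) (\<lambda>k. if k = 0 then - 1 else if k = N then 1 else 0)"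


section \<open>Blocks\<close>

definition ref_square :: "(real ^ 2) set" where
  "ref_square = {\<xi>. \<forall>i. - 1 \<le> \<xi> $ i \<and> \<xi> $ i \<le> 1}"

text \<open>
  \<open>dcoord \<xi> $ i $ j\<close> is \<open>\<partial>x\<^sub>i / \<partial>\<xi>\<^sub>j\<close> at the reference point \<open>\<xi>\<close>, whereas
  \<open>dcoord_inv x $ i $ j\<close> is \<open>\<partial>\<xi>\<^sub>i / \<partial>x\<^sub>j\<close> at the physical point \<open>x\<close>. The predicate \<open>sbp_block\<close>
  below says that they are these derivatives.
\<close>

record sbp_block_data =
  grid_deg :: "2 \<Rightarrow> nat"
  norm_mat :: "2 \<Rightarrow> real mat"
  Q_mat :: "2 \<Rightarrow> real mat"
  coord :: "real ^ 2 \<Rightarrow> real ^ 2"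
  coord_inv :: "real ^ 2 \<Rightarrow> real ^ 2"
  dcoord :: "real ^ 2 \<Rightarrow> real ^ 2 ^ 2"
  dcoord_inv :: "real ^ 2 \<Rightarrow> real ^ 2 ^ 2"

definition jacobian :: "sbp_block_data \<Rightarrow> real ^ 2 \<Rightarrow> real" where
  "jacobian B \<xi> = det (dcoord B \<xi>)"

definition sbp_block :: "sbp_block_data \<Rightarrow> bool" where
  "sbp_block B \<longleftrightarrow>
     (\<forall>a. sbp_operator (grid_deg B a) (norm_mat B a) (Q_mat B a)) \<and>
     (\<forall>\<xi> \<in> ref_square.
        coord_inv B (coord B \<xi>) = \<xi> \<and>
        (coord B has_derivative (\<lambda>h. dcoord B \<xi> *v h)) (at \<xi> within ref_square) \<and>
        (coord_inv B has_derivative (\<lambda>h. dcoord_inv B (coord B \<xi>) *v h))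
          (at (coord B \<xi>) within coord B ` ref_square) \<and>
        0 < jacobian B \<xi>)"

text \<open>The reference coordinate with index \<open>2\<close> runs fastest.\<close>

definition block_size :: "sbp_block_data \<Rightarrow> nat" where
  "block_size B = (grid_deg B 1 + 1) * (grid_deg B 2 + 1)"

definition grid_index :: "sbp_block_data \<Rightarrow> nat \<Rightarrow> nat \<Rightarrow> nat" where
  "grid_index B i j = i * (grid_deg B 2 + 1) + j"


section \<open>Edges\<close>

datatype edge = West | East | South | North

text \<open>
  On the edge \<open>K\<close> the coordinate with index \<open>edge_dir K\<close> is constant, with value \<open>edge_sign K\<close>, and
  the coordinate with index \<open>edge_tan K\<close> varies.
\<close>

fun edge_dir :: "edge \<Rightarrow> 2" where
  "edge_dir West = 1"
| "edge_dir East = 1"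
| "edge_dir South = 2"
| "edge_dir North = 2"

fun edge_tan :: "edge \<Rightarrow> 2" where
  "edge_tan West = 2"
| "edge_tan East = 2"
| "edge_tan South = 1"
| "edge_tan North = 1"

fun edge_sign :: "edge \<Rightarrow> real" where
  "edge_sign West = - 1"
| "edge_sign East = 1"
| "edge_sign South = - 1"
| "edge_sign North = 1"

definition edge_point :: "edge \<Rightarrow> real \<Rightarrow> real ^ 2" where
  "edge_point K \<eta> = (\<chi> i. if i = edge_dir K then edge_sign K else \<eta>)"

definition edge_size :: "sbp_block_data \<Rightarrow> edge \<Rightarrow> nat" where
  "edge_size B K = grid_deg B (edge_tan K) + 1"

definition edge_grid_point :: "sbp_block_data \<Rightarrow> edge \<Rightarrow> nat \<Rightarrow> real ^ 2" where
  "edge_grid_point B K k = edge_point K (- 1 + 2 * real k / real (grid_deg B (edge_tan K)))"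

fun edge_index :: "sbp_block_data \<Rightarrow> edge \<Rightarrow> nat \<Rightarrow> nat" where
  "edge_index B West k = grid_index B 0 k"
| "edge_index B East k = grid_index B (grid_deg B 1) k"
| "edge_index B South k = grid_index B k 0"
| "edge_index B North k = grid_index B k (grid_deg B 2)"

definition edge_restrict :: "sbp_block_data \<Rightarrow> edge \<Rightarrow> real vec \<Rightarrow> real vec" where
  "edge_restrict B K u = Matrix.vec (edge_size B K) (\<lambda>k. vec_index u (edge_index B K k))"

definition edge_norm_mat :: "sbp_block_data \<Rightarrow> edge \<Rightarrow> real mat" where
  "edge_norm_mat B K = norm_mat B (edge_tan K)"

definition surface_jacobian :: "sbp_block_data \<Rightarrow> edge \<Rightarrow> real ^ 2 \<Rightarrow> real" where
  "surface_jacobian B K \<xi> =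
     jacobian B \<xi> * sqrt ((dcoord_inv B (coord B \<xi>) $ edge_dir K $ 1)\<^sup>2
                        + (dcoord_inv B (coord B \<xi>) $ edge_dir K $ 2)\<^sup>2)"

definition outward_normal :: "sbp_block_data \<Rightarrow> edge \<Rightarrow> 2 \<Rightarrow> real ^ 2 \<Rightarrow> real" where
  "outward_normal B K i \<xi> =
     edge_sign K * (jacobian B \<xi> / surface_jacobian B K \<xi>)
       * (dcoord_inv B (coord B \<xi>) $ edge_dir K $ i)"

definition surface_jacobian_mat :: "sbp_block_data \<Rightarrow> edge \<Rightarrow> real mat" where
  "surface_jacobian_mat B K =
     mat_diag (edge_size B K) (\<lambda>k. surface_jacobian B K (edge_grid_point B K k))"

definition outward_normal_mat :: "sbp_block_data \<Rightarrow> edge \<Rightarrow> 2 \<Rightarrow> real mat" where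
  "outward_normal_mat B K i =
     mat_diag (edge_size B K) (\<lambda>k. outward_normal B K i (edge_grid_point B K k))"

definition edge_normal_velocity ::
    "sbp_block_data \<Rightarrow> edge \<Rightarrow> real vec \<Rightarrow> real vec \<Rightarrow> real vec" where
  "edge_normal_velocity B K v1 v2 =
     outward_normal_mat B K 1 *\<^sub>v edge_restrict B K v1
       + outward_normal_mat B K 2 *\<^sub>v edge_restrict B K v2"

text \<open>
  \<open>\<D>\<^sub>K\<close> for the block state with velocity components \<open>v1\<close>, \<open>v2\<close> and pressure \<open>p\<close>, given the
  vectors \<open>pstar\<close>, \<open>vstar\<close> prescribed on the edge. No time derivative is involved, so the state is
  the one at an arbitrary fixed time.
\<close>

definition dissipation_rate ::
    "sbp_block_data \<Rightarrow> edge \<Rightarrow> real vec \<Rightarrow> real vec \<Rightarrow> real vec \<Rightarrow> real vec \<Rightarrow> real vec \<Rightarrow> real" where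
  "dissipation_rate B K v1 v2 p pstar vstar =
     (let HS = edge_norm_mat B K * surface_jacobian_mat B K;
          vK = edge_normal_velocity B K v1 v2;
          pK = edge_restrict B K p
      in - (vK \<bullet> (HS *\<^sub>v pstar)) + vK \<bullet> (HS *\<^sub>v pK) - vstar \<bullet> (HS *\<^sub>v pK))"


section \<open>Interface and glue grid\<close>

text \<open>
  The two blocks have the same continuous parametrization of the interface; \<open>s = - 1\<close> is the case
  in which the two edges are traversed in opposite directions (for instance East glued to East).
  Nothing relates the grids and the SBP operators of the two blocks.
\<close>

definition block_interface ::
    "sbp_block_data \<Rightarrow> edge \<Rightarrow> sbp_block_data \<Rightarrow> edge \<Rightarrow> bool" where
  "block_interface Bm Km Bp Kp \<longleftrightarrow>
     (\<exists>s \<in> {1, - 1}. \<forall>\<eta> \<in> {- 1..1}.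
        coord Bm (edge_point Km \<eta>) = coord Bp (edge_point Kp (s * \<eta>)))"

text \<open>
  Linear independence is linear independence in \<open>L\<^sup>2\<close>, hence up to null sets. The interface is
  parametrized by \<open>\<eta> \<in> [-1,1]\<close>.
\<close>

definition glue_basis :: "nat \<Rightarrow> (nat \<Rightarrow> real \<Rightarrow> real) \<Rightarrow> bool" where
  "glue_basis m \<psi> \<longleftrightarrow>
     (\<forall>i<m. \<psi> i \<in> borel_measurable (lebesgue_on {- 1..1}) \<and>
            integrable (lebesgue_on {- 1..1}) (\<lambda>\<eta>. (\<psi> i \<eta>)\<^sup>2)) \<and>
     (\<forall>c. (AE \<eta> in lebesgue_on {- 1..1}. (\<Sum>i<m. c i * \<psi> i \<eta>) = 0) \<longrightarrow> (\<forall>i<m. c i = 0))"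

definition glue_mass_mat :: "nat \<Rightarrow> (nat \<Rightarrow> real \<Rightarrow> real) \<Rightarrow> real mat" where
  "glue_mass_mat m \<psi> =
     Matrix.mat m m (\<lambda>(i, j). integral\<^sup>L (lebesgue_on {- 1..1}) (\<lambda>\<eta>. \<psi> i \<eta> * \<psi> j \<eta>))"

definition norm_compatible :: "nat \<Rightarrow> nat \<Rightarrow> real mat \<Rightarrow> real mat \<Rightarrow> real mat \<Rightarrow> real mat \<Rightarrow> bool" where
  "norm_compatible m n M H Pf2g Pg2f \<longleftrightarrow>
     Pf2g \<in> carrier_mat m n \<and> Pg2f \<in> carrier_mat n m \<and>
     transpose_mat Pg2f * H = M * Pf2g"

definition to_glue :: "real mat \<Rightarrow> real mat \<Rightarrow> real vec \<Rightarrow> real vec" where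
  "to_glue Pf2g S w = Pf2g *\<^sub>v (diag_mat_powr S (1/2) *\<^sub>v w)"

text \<open>
  \<open>glue_jump_p\<close> is \<open>pbar* - pbar\<close> and \<open>glue_jump_v\<close> is \<open>vbar* - vbar\<close>, seen from the side with glue
  values \<open>pbar\<close>, \<open>vbar\<close>; the glue values of the other side are \<open>pbar'\<close>, \<open>vbar'\<close>.
\<close>

definition glue_jump_p ::
    "real \<Rightarrow> real \<Rightarrow> real vec \<Rightarrow> real vec \<Rightarrow> real vec \<Rightarrow> real vec \<Rightarrow> real vec" where
  "glue_jump_p \<alpha> Z pbar vbar pbar' vbar' =
     (1/2) \<cdot>\<^sub>v (pbar' - pbar) + (\<alpha> * (Z / 2)) \<cdot>\<^sub>v (vbar' + vbar)"

definition glue_jump_v ::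
    "real \<Rightarrow> real \<Rightarrow> real vec \<Rightarrow> real vec \<Rightarrow> real vec \<Rightarrow> real vec \<Rightarrow> real vec" where
  "glue_jump_v \<alpha> Z pbar vbar pbar' vbar' =
     - ((1/2) \<cdot>\<^sub>v (vbar' + vbar)) - (\<alpha> * (1 / (2 * Z))) \<cdot>\<^sub>v (pbar' - pbar)"

text \<open>\<open>w* - w\<close> on the edge grid, from \<open>dwbar = wbar* - wbar\<close> on the glue grid.\<close>

definition grid_jump :: "real mat \<Rightarrow> real mat \<Rightarrow> real vec \<Rightarrow> real vec \<Rightarrow> real vec \<Rightarrow> real vec" where
  "grid_jump S Pg2f dwbar wbar w =
     diag_mat_powr S (- (1/2)) *\<^sub>v (Pg2f *\<^sub>v dwbar)
       + (1/2) \<cdot>\<^sub>v (diag_mat_powr S (- (1/2)) *\<^sub>v (Pg2f *\<^sub>v wbar) - w)"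

end

theory Submission
  imports Defs
begin

text \<open>
  Compatibility of the projections turns \<open>v\<^sup>T H S\<^sub>J\<close> applied to the grid jump of \<open>w\<close> into the glue-grid
  form \<open>vbar\<^sup>T M (wbar* - wbar / 2)\<close> minus half of \<open>v\<^sup>T H S\<^sub>J w\<close>. Adding the pressure and the velocity
  contributions of one side, the terms living on the fine grid cancel, and the dissipation rate is
  \<open>- vbar\<^sup>T M (pbar* - pbar) - (vbar* - vbar)\<^sup>T M pbar - vbar\<^sup>T M pbar\<close>. The theorem is then an
  identity for the symmetric bilinear form of \<open>M\<close>.
  The surface Jacobian is positive, so that \<open>S\<^sub>J\<^sup>-\<^sup>1\<^sup>/\<^sup>2\<close> is an inverse of \<open>S\<^sub>J\<^sup>1\<^sup>/\<^sup>2\<close>, because the two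
  coordinate derivatives are inverse to each other, up to the boundary of the reference square.
\<close>

section \<open>Positivity of the surface Jacobian\<close>

lemma ref_square_eq_cbox: "ref_square = cbox (\<chi> i. - 1) (\<chi> i. 1)"
  by (auto simp: ref_square_def mem_box_cart)

text \<open>The chain rule for \<open>coord_inv B\<close> after \<open>coord B\<close>, whose
  composite is the identity on the square. The edges lie on the boundary of the square, so every
  derivative here is taken within a set.\<close>

lemma dcoord_inv_mult_dcoord:
  assumes B: "sbp_block B" and \<xi>: "\<xi> \<in> ref_square"
  shows "dcoord_inv B (coord B \<xi>) ** dcoord B \<xi> = (Finite_Cartesian_Product.mat 1 :: real ^ 2 ^ 2)"
proof -
  let ?f' = "\<lambda>h. dcoord B \<xi> *v h" and ?g' = "\<lambda>h. dcoord_inv B (coord B \<xi>) *v h"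
  from B \<xi> have "(coord B has_derivative ?f') (at \<xi> within ref_square)"
    and "(coord_inv B has_derivative ?g') (at (coord B \<xi>) within coord B ` ref_square)"
    unfolding sbp_block_def by blast+
  then have "(coord_inv B \<circ> coord B has_derivative ?g' \<circ> ?f') (at \<xi> within ref_square)"
    by (rule diff_chain_within)
  \<comment> \<open>The composite equals \<open>id\<close> only on \<open>ref_square\<close>, which
    is enough for a derivative within that set.\<close>
  then have "(id has_derivative ?g' \<circ> ?f') (at \<xi> within ref_square)"
    by (rule has_derivative_transform[OF \<xi>, rotated])
      (use B in \<open>auto simp: sbp_block_def\<close>)
  moreover have "(id has_derivative id) (at \<xi> within ref_square)"
    by (rule has_derivative_id)
  \<comment> \<open>Derivatives within a set need not be unique; they are within a closed box of
    positive width in each direction, boundary points included.\<close>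
  ultimately have "?g' \<circ> ?f' = id"
    using \<xi> unfolding ref_square_eq_cbox
    by (intro frechet_derivative_unique_within_closed_interval[of "\<chi> i. - 1" "\<chi> i. 1" \<xi> id])
      (auto simp: Basis_vec_def inner_axis)
  then have "(dcoord_inv B (coord B \<xi>) ** dcoord B \<xi>) *v h = Finite_Cartesian_Product.mat 1 *v h" for h
    by (metis comp_apply id_apply matrix_vector_mul_assoc matrix_vector_mul_lid)
  then show ?thesis
    by (simp add: matrix_eq)
qed

text \<open>A diagonal entry of the product with \<open>dcoord B \<xi>\<close> equals 1, so the row
  of \<open>dcoord_inv\<close> belonging to the edge direction cannot vanish and the root in the
  surface Jacobian is positive.\<close>

lemma surface_jacobian_pos:
  assumes B: "sbp_block B" and \<xi>: "\<xi> \<in> ref_square"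
  shows "0 < surface_jacobian B K \<xi>"
proof -
  let ?A = "dcoord_inv B (coord B \<xi>)" and ?i = "edge_dir K"
  have "(?A ** dcoord B \<xi>) $ ?i $ ?i = 1"
    by (simp add: dcoord_inv_mult_dcoord[OF B \<xi>] Finite_Cartesian_Product.mat_def)
  then have "?A $ ?i $ 1 * dcoord B \<xi> $ 1 $ ?i + ?A $ ?i $ 2 * dcoord B \<xi> $ 2 $ ?i = 1"
    by (simp add: matrix_matrix_mult_def sum_2)
  then have "?A $ ?i $ 1 \<noteq> 0 \<or> ?A $ ?i $ 2 \<noteq> 0"
    by auto
  then have "0 < (?A $ ?i $ 1)\<^sup>2 + (?A $ ?i $ 2)\<^sup>2"
    by (simp add: sum_power2_gt_zero_iff)
  moreover have "0 < jacobian B \<xi>"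
    using B \<xi> by (simp add: sbp_block_def)
  ultimately show ?thesis
    by (simp add: surface_jacobian_def)
qed

lemma edge_grid_point_in_ref_square:
  assumes B: "sbp_block B" and k: "k < edge_size B K"
  shows "edge_grid_point B K k \<in> ref_square"
proof -
  let ?N = "grid_deg B (edge_tan K)"
  have N: "1 \<le> ?N"
    using B by (auto simp: sbp_block_def sbp_operator_def)
  have "real k \<le> real ?N"
    using k by (simp add: edge_size_def)
  with N have "0 \<le> 2 * real k / real ?N" "2 * real k / real ?N \<le> 2"
    by (auto simp: divide_simps)
  moreover have "edge_sign K \<in> {- 1, 1}"
    by (cases K) auto
  ultimately show ?thesis
    by (auto simp: edge_grid_point_def edge_point_def ref_square_def)
qed


section \<open>The glue-grid mass matrix\<close>

lemma glue_mass_mat_carrier [simp]: "glue_mass_mat m \<psi> \<in> carrier_mat m m"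
  by (simp add: glue_mass_mat_def)

lemma transpose_glue_mass_mat: "transpose_mat (glue_mass_mat m \<psi>) = glue_mass_mat m \<psi>"
  by (rule eq_matI) (auto simp: glue_mass_mat_def mult.commute)

text \<open>From \<open>2 * \<bar>f x\<bar> * \<bar>g x\<bar> \<le> (f x)\<^sup>2 + (g
  x)\<^sup>2\<close>. It makes the entries of the mass matrix genuine integrals instead of the
  default value 0 of a non-integrable function.\<close>

lemma integrable_mult_of_square_integrable:
  fixes f g :: "'a \<Rightarrow> real"
  assumes [measurable]: "f \<in> borel_measurable N" "g \<in> borel_measurable N"
    and f: "integrable N (\<lambda>x. (f x)\<^sup>2)" and g: "integrable N (\<lambda>x. (g x)\<^sup>2)"
  shows "integrable N (\<lambda>x. f x * g x)"
proof (rule Bochner_Integration.integrable_bound[OF Bochner_Integration.integrable_add[OF f g]])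
  show "AE x in N. norm (f x * g x) \<le> norm ((f x)\<^sup>2 + (g x)\<^sup>2)"
  proof (rule AE_I2)
    fix x
    have "2 * \<bar>f x\<bar> * \<bar>g x\<bar> \<le> (f x)\<^sup>2 + (g x)\<^sup>2"
      using sum_squares_bound[of "\<bar>f x\<bar>" "\<bar>g x\<bar>"] by simp
    moreover have "0 \<le> \<bar>f x\<bar> * \<bar>g x\<bar>"
      by simp
    ultimately have "\<bar>f x * g x\<bar> \<le> (f x)\<^sup>2 + (g x)\<^sup>2"
      unfolding abs_mult by linarith
    then show "norm (f x * g x) \<le> norm ((f x)\<^sup>2 + (g x)\<^sup>2)"
      by simp
  qed
qed measurable

text \<open>The quadratic form is the integral of the square of the glue function with coefficient
  vector \<open>u\<close>.\<close>

lemma glue_mass_mat_nonneg: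
  assumes \<psi>: "glue_basis m \<psi>" and u: "u \<in> carrier_vec m"
  shows "0 \<le> u \<bullet> (glue_mass_mat m \<psi> *\<^sub>v u)"
proof -
  let ?L = "lebesgue_on {- 1..1 :: real}"
  let ?u = "vec_index u"
  \<comment> \<open>Integrability of each term is what allows both finite sums to be moved under the
    integral.\<close>
  have int: "integrable ?L (\<lambda>\<eta>. ?u i * ?u j * (\<psi> i \<eta> * \<psi> j \<eta>))" if "i < m" "j < m" for i j
    using \<psi> that
    by (intro integrable_mult_right integrable_mult_of_square_integrable) (auto simp: glue_basis_def)
  have "u \<bullet> (glue_mass_mat m \<psi> *\<^sub>v u)
      = (\<Sum>i<m. ?u i * (\<Sum>j<m. integral\<^sup>L ?L (\<lambda>\<eta>. \<psi> i \<eta> * \<psi> j \<eta>) * ?u j))"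
    using u by (auto simp: scalar_prod_def glue_mass_mat_def atLeast0LessThan intro!: sum.cong)
  also have "\<dots> = (\<Sum>i<m. \<Sum>j<m. integral\<^sup>L ?L (\<lambda>\<eta>. ?u i * ?u j * (\<psi> i \<eta> * \<psi> j \<eta>)))"
    by (simp add: sum_distrib_left algebra_simps)
  also have "\<dots> = (\<Sum>i<m. integral\<^sup>L ?L (\<lambda>\<eta>. \<Sum>j<m. ?u i * ?u j * (\<psi> i \<eta> * \<psi> j \<eta>)))"
    by (intro sum.cong refl Bochner_Integration.integral_sum[symmetric] int) auto
  also have "\<dots> = integral\<^sup>L ?L (\<lambda>\<eta>. \<Sum>i<m. \<Sum>j<m. ?u i * ?u j * (\<psi> i \<eta> * \<psi> j \<eta>))"
    by (intro Bochner_Integration.integral_sum[symmetric] Bochner_Integration.integrable_sum int) auto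
  also have "\<dots> = integral\<^sup>L ?L (\<lambda>\<eta>. (\<Sum>i<m. ?u i * \<psi> i \<eta>)\<^sup>2)"
    by (simp add: power2_eq_square sum_product algebra_simps)
  also have "\<dots> \<ge> 0"
    by simp
  finally show ?thesis .
qed


section \<open>The symmetric bilinear form of the mass matrix\<close>

lemma scalar_prod_mult_mat_vec_commute:
  fixes M :: "real mat"
  assumes "M \<in> carrier_mat m m" "transpose_mat M = M" "x \<in> carrier_vec m" "y \<in> carrier_vec m"
  shows "x \<bullet> (M *\<^sub>v y) = y \<bullet> (M *\<^sub>v x)"
  using transpose_vec_mult_scalar[OF assms(1,4,3)] assms
    comm_scalar_prod[of "M *\<^sub>v x" m y] mult_mat_vec_carrier[OF assms(1,3)]
  by simp

text \<open>The parts without \<alpha> reduce on the first side to half of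
  \<open>p \<bullet> (M *\<^sub>v v') - v \<bullet> (M *\<^sub>v p')\<close>. Exchanging the sides
  flips its sign, by symmetry of \<open>M\<close>, so the sum is zero. The \<alpha> parts of the two
  sides combine into the two squares.\<close>

lemma glue_jumps_identity:
  fixes M :: "real mat"
  assumes M: "M \<in> carrier_mat m m" and sym: "transpose_mat M = M"
    and carr: "p \<in> carrier_vec m" "v \<in> carrier_vec m" "p' \<in> carrier_vec m" "v' \<in> carrier_vec m"
  shows "- (v \<bullet> (M *\<^sub>v glue_jump_p \<alpha> Z p v p' v')) - p \<bullet> (M *\<^sub>v glue_jump_v \<alpha> Z p v p' v')
           - v \<bullet> (M *\<^sub>v p)
       + (- (v' \<bullet> (M *\<^sub>v glue_jump_p \<alpha> Z p' v' p v)) - p' \<bullet> (M *\<^sub>v glue_jump_v \<alpha> Z p' v' p v)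
           - v' \<bullet> (M *\<^sub>v p'))
       = - (\<alpha> * (Z / 2)) * ((v + v') \<bullet> (M *\<^sub>v (v + v')))
         - \<alpha> * (1 / (2 * Z)) * ((p - p') \<bullet> (M *\<^sub>v (p - p')))"
proof -
  note comm = scalar_prod_mult_mat_vec_commute[OF M sym]
  note c = mult_mat_vec_carrier[OF M]
  \<comment> \<open>Writing the negation as a scalar multiple lets the linearity rules for
    \<open>M\<close> handle it.\<close>
  have neg: "- ((1/2) \<cdot>\<^sub>v z) = (- (1/2)) \<cdot>\<^sub>v z" for z :: "real vec"
    by (intro eq_vecI) auto
  have jump_p: "x \<bullet> (M *\<^sub>v glue_jump_p \<alpha> Z q w q' w')
      = (1/2) * (x \<bullet> (M *\<^sub>v q') - x \<bullet> (M *\<^sub>v q))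
        + (\<alpha> * (Z / 2)) * (x \<bullet> (M *\<^sub>v w') + x \<bullet> (M *\<^sub>v w))"
    and jump_v: "x \<bullet> (M *\<^sub>v glue_jump_v \<alpha> Z q w q' w')
      = - ((1/2) * (x \<bullet> (M *\<^sub>v w') + x \<bullet> (M *\<^sub>v w)))
        - (\<alpha> * (1 / (2 * Z))) * (x \<bullet> (M *\<^sub>v q') - x \<bullet> (M *\<^sub>v q))"
    if "x \<in> carrier_vec m" "q \<in> carrier_vec m" "w \<in> carrier_vec m" "q' \<in> carrier_vec m"
       "w' \<in> carrier_vec m" for x q w q' w'
    using that c unfolding glue_jump_p_def glue_jump_v_def neg
    by (simp_all add: mult_add_distrib_mat_vec[OF M] mult_minus_distrib_mat_vec[OF M]
        mult_mat_vec[OF M] scalar_prod_add_distrib[of _ m] scalar_prod_minus_distrib[of _ m])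
  have square: "(v + v') \<bullet> (M *\<^sub>v (v + v'))
      = v \<bullet> (M *\<^sub>v v) + v \<bullet> (M *\<^sub>v v') + v' \<bullet> (M *\<^sub>v v) + v' \<bullet> (M *\<^sub>v v')"
    "(p - p') \<bullet> (M *\<^sub>v (p - p'))
      = p \<bullet> (M *\<^sub>v p) - p \<bullet> (M *\<^sub>v p') - p' \<bullet> (M *\<^sub>v p) + p' \<bullet> (M *\<^sub>v p')"
    using carr c
    by (simp_all add: mult_add_distrib_mat_vec[OF M] mult_minus_distrib_mat_vec[OF M]
        scalar_prod_add_distrib[of _ m] scalar_prod_minus_distrib[of _ m]
        add_scalar_prod_distrib[of _ m] minus_scalar_prod_distrib[of _ m])
  \<comment> \<open>The instances of \<open>comm\<close> give each mixed product one orientation: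
    velocity before pressure, unprimed before primed within a kind. The rest is real
    algebra.\<close>
  show ?thesis
    using carr
    by (simp add: jump_p jump_v square comm[of v' v] comm[of p' p] comm[of p v] comm[of p v']
        comm[of p' v] comm[of p' v'] algebra_simps)
qed


section \<open>Moving the penalty terms to the glue grid\<close>

lemma diagonal_mat_mult_vec_index:
  fixes H :: "real mat"
  assumes "H \<in> carrier_mat n n" "diagonal_mat H" "x \<in> carrier_vec n" "k < n"
  shows "vec_index (H *\<^sub>v x) k = H $$ (k, k) * vec_index x k"
proof -
  have "vec_index (H *\<^sub>v x) k = (\<Sum>j\<in>{0..<n}. H $$ (k, j) * vec_index x j)"
    using assms by (simp add: scalar_prod_def)
  also have "\<dots> = (\<Sum>j\<in>{0..<n}. if j = k then H $$ (k, k) * vec_index x k else 0)"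
    using assms by (intro sum.cong) (auto simp: diagonal_mat_def)
  finally show ?thesis
    using assms by simp
qed

lemma mat_diag_mult_vec_carrier [simp]: "mat_diag n s *\<^sub>v x \<in> carrier_vec n"
  by (simp add: carrier_dim_vec mat_diag_def)

lemma diag_mat_powr_mat_diag:
  "diag_mat_powr (mat_diag n s) r = mat_diag n (\<lambda>k. s k powr r)"
  by (rule eq_matI) (auto simp: diag_mat_powr_def mat_diag_def)

lemma mat_diag_mult_vec_index:
  fixes x :: "real vec"
  assumes "x \<in> carrier_vec n" "k < n"
  shows "vec_index (mat_diag n s *\<^sub>v x) k = s k * vec_index x k"
  using diagonal_mat_mult_vec_index[of "mat_diag n s" n x k] assms
  by (simp add: diagonal_mat_def mat_diag_def)

text \<open>Both factors are diagonal, so the form is a weighted componentwise sum. Its symmetry in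
  \<open>x\<close> and \<open>y\<close> becomes visible this way.\<close>

lemma scalar_prod_norm_surface:
  fixes H :: "real mat"
  assumes "H \<in> carrier_mat n n" "diagonal_mat H" "x \<in> carrier_vec n" "y \<in> carrier_vec n"
  shows "x \<bullet> ((H * mat_diag n s) *\<^sub>v y)
       = (\<Sum>k<n. H $$ (k, k) * s k * vec_index x k * vec_index y k)"
proof -
  have "(H * mat_diag n s) *\<^sub>v y = H *\<^sub>v (mat_diag n s *\<^sub>v y)"
    using assms by (intro assoc_mult_mat_vec) auto
  then show ?thesis
    using assms
    by (auto simp: scalar_prod_def[of x] diagonal_mat_mult_vec_index[OF assms(1,2)]
        mat_diag_mult_vec_index atLeast0LessThan intro!: sum.cong
        simp del: index_mult_mat_vec)
qed

text \<open>Of the full weight \<open>s\<close>, one half power cancels against the inverse root and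
  the other is absorbed by \<open>x\<close>, as \<open>to_glue\<close> requires. Compatibility then
  replaces \<open>transpose_mat Pg * H\<close> by \<open>M * Pf\<close>.\<close>

lemma scalar_prod_norm_surface_project:
  fixes H :: "real mat"
  assumes H: "H \<in> carrier_mat n n" "diagonal_mat H"
    and s: "\<forall>k<n. 0 < s k"
    and M: "M \<in> carrier_mat m m" "transpose_mat M = M"
    and compat: "norm_compatible m n M H Pf Pg"
    and x: "x \<in> carrier_vec n" and d: "d \<in> carrier_vec m"
  shows "x \<bullet> ((H * mat_diag n s) *\<^sub>v (diag_mat_powr (mat_diag n s) (- (1/2)) *\<^sub>v (Pg *\<^sub>v d)))
       = to_glue Pf (mat_diag n s) x \<bullet> (M *\<^sub>v d)"
proof -
  from compat have Pf: "Pf \<in> carrier_mat m n" and Pg: "Pg \<in> carrier_mat n m"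
    and PH: "transpose_mat Pg * H = M * Pf"
    by (auto simp: norm_compatible_def)
  define T where "T = mat_diag n (\<lambda>k. s k powr (1/2))"
  define y where "y = Pg *\<^sub>v d"
  have y: "y \<in> carrier_vec n" and Tx: "T *\<^sub>v x \<in> carrier_vec n"
    using Pg d by (simp_all add: y_def T_def)
  have T_index: "vec_index (T *\<^sub>v x) k = s k powr (1/2) * vec_index x k" if "k < n" for k
    using that x by (simp only: T_def mat_diag_mult_vec_index)
  have "x \<bullet> ((H * mat_diag n s) *\<^sub>v (diag_mat_powr (mat_diag n s) (- (1/2)) *\<^sub>v y))
      = (\<Sum>k<n. H $$ (k, k) * s k * vec_index x k * (s k powr (- (1/2)) * vec_index y k))"
    by (subst scalar_prod_norm_surface[OF H x])
      (auto simp: diag_mat_powr_mat_diag mat_diag_mult_vec_index[OF y]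
        simp del: index_mult_mat_vec)
  also have "\<dots> = (\<Sum>k<n. H $$ (k, k) * (s k powr (1/2) * vec_index x k) * vec_index y k)"
  proof (intro sum.cong refl)
    fix k assume "k \<in> {..<n}"
    then have "0 < s k" using s by simp
    \<comment> \<open>The exponents 1 and -1/2 add up to 1/2, and \<open>s k powr 1\<close> is
      \<open>s k\<close> because \<open>s k\<close> is positive.\<close>
    then have "s k * s k powr (- (1/2)) = s k powr (1/2)"
      using powr_add[of "s k" 1 "- (1/2)"] by simp
    then show "H $$ (k, k) * s k * vec_index x k * (s k powr (- (1/2)) * vec_index y k)
        = H $$ (k, k) * (s k powr (1/2) * vec_index x k) * vec_index y k"
      by (metis mult.assoc mult.left_commute)
  qed
  also have "\<dots> = (H *\<^sub>v (T *\<^sub>v x)) \<bullet> y"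
    using y by (auto simp: scalar_prod_def[of _ y] diagonal_mat_mult_vec_index[OF H Tx]
        T_index atLeast0LessThan simp del: index_mult_mat_vec
        intro!: sum.cong)
  also have "\<dots> = (transpose_mat Pg *\<^sub>v (H *\<^sub>v (T *\<^sub>v x))) \<bullet> d"
    unfolding y_def using H Tx
    by (intro transpose_vec_mult_scalar[OF Pg d, symmetric]) (simp add: mult_mat_vec_carrier[of _ n n])
  \<comment> \<open>The only place where the compatibility equation enters.\<close>
  also have "transpose_mat Pg *\<^sub>v (H *\<^sub>v (T *\<^sub>v x)) = M *\<^sub>v (Pf *\<^sub>v (T *\<^sub>v x))"
    using assoc_mult_mat_vec[OF _ H(1) Tx, of "transpose_mat Pg" m] Pg PH
      assoc_mult_mat_vec[OF M(1) Pf Tx]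
    by simp
  also have "\<dots> \<bullet> d = (Pf *\<^sub>v (T *\<^sub>v x)) \<bullet> (M *\<^sub>v d)"
    using transpose_vec_mult_scalar[OF M(1) d, of "Pf *\<^sub>v (T *\<^sub>v x)"] M(2) Pf Tx
    by simp
  finally show ?thesis
    by (simp add: y_def T_def to_glue_def diag_mat_powr_mat_diag)
qed

text \<open>By linearity \<open>grid_jump\<close> splits into three terms. The two projected ones
  move to the glue grid; \<open>w\<close> itself is not projected and leaves an edge-grid
  term.\<close>

lemma scalar_prod_norm_surface_grid_jump:
  fixes H :: "real mat"
  assumes H: "H \<in> carrier_mat n n" "diagonal_mat H"
    and s: "\<forall>k<n. 0 < s k"
    and M: "M \<in> carrier_mat m m" "transpose_mat M = M"
    and compat: "norm_compatible m n M H Pf Pg"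
    and x: "x \<in> carrier_vec n" and w: "w \<in> carrier_vec n"
    and d: "d \<in> carrier_vec m" and b: "b \<in> carrier_vec m"
  shows "x \<bullet> ((H * mat_diag n s) *\<^sub>v grid_jump (mat_diag n s) Pg d b w)
       = to_glue Pf (mat_diag n s) x \<bullet> (M *\<^sub>v d)
         + (1/2) * (to_glue Pf (mat_diag n s) x \<bullet> (M *\<^sub>v b))
         - (1/2) * (x \<bullet> ((H * mat_diag n s) *\<^sub>v w))"
proof -
  define A where "A = H * mat_diag n s"
  let ?u = "\<lambda>d. diag_mat_powr (mat_diag n s) (- (1/2)) *\<^sub>v (Pg *\<^sub>v d)"
  have A: "A \<in> carrier_mat n n"
    using H by (simp add: A_def)
  have u: "?u d \<in> carrier_vec n" for d
    by (simp add: diag_mat_powr_mat_diag)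
  have c: "A *\<^sub>v y \<in> carrier_vec n" for y
    using A by (simp add: carrier_dim_vec)
  have "x \<bullet> (A *\<^sub>v grid_jump (mat_diag n s) Pg d b w)
      = x \<bullet> (A *\<^sub>v ?u d) + (1/2) * (x \<bullet> (A *\<^sub>v ?u b) - x \<bullet> (A *\<^sub>v w))"
    unfolding grid_jump_def using u w x c
    by (simp add: mult_add_distrib_mat_vec[OF A] mult_minus_distrib_mat_vec[OF A]
        mult_mat_vec[OF A] scalar_prod_add_distrib[of _ n] scalar_prod_minus_distrib[of _ n])
  then show ?thesis
    using scalar_prod_norm_surface_project[OF H s M compat x, folded A_def] d b
    by (simp add: A_def[symmetric] right_diff_distrib)
qed

section \<open>Dissipation rate of one side\<close>

lemma to_glue_carrier:
  "norm_compatible m n M H Pf Pg \<Longrightarrow> to_glue Pf S w \<in> carrier_vec m"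
  by (auto simp: norm_compatible_def to_glue_def carrier_dim_vec)

lemma glue_jump_carrier:
  assumes "p \<in> carrier_vec m" "v \<in> carrier_vec m" "p' \<in> carrier_vec m" "v' \<in> carrier_vec m"
  shows "glue_jump_p \<alpha> Z p v p' v' \<in> carrier_vec m" "glue_jump_v \<alpha> Z p v p' v' \<in> carrier_vec m"
  using assms by (auto simp: glue_jump_p_def glue_jump_v_def)

lemma edge_restrict_carrier: "edge_restrict B K u \<in> carrier_vec (edge_size B K)"
  by (simp add: edge_restrict_def)

lemma edge_normal_velocity_carrier:
  "edge_normal_velocity B K v1 v2 \<in> carrier_vec (edge_size B K)"
  by (simp add: edge_normal_velocity_def outward_normal_mat_def)

text \<open>The pressure and the velocity jump each leave
  \<open>(1/2) * (vK \<bullet> (A *\<^sub>v pK))\<close> on the edge grid, where \<open>A\<close> is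
  the norm matrix times the surface Jacobian matrix. Together they cancel the remaining
  \<open>- (vK \<bullet> (A *\<^sub>v pK))\<close>; the factor 1/2 in \<open>grid_jump\<close> is
  what achieves this.\<close>

lemma dissipation_rate_glue:
  fixes B :: sbp_block_data
  assumes B: "sbp_block B"
    and M: "M \<in> carrier_mat m m" "transpose_mat M = M"
    and compat: "norm_compatible m (edge_size B K) M (edge_norm_mat B K) Pf Pg"
    and S: "S = surface_jacobian_mat B K"
    and w: "pK = edge_restrict B K p" "vK = edge_normal_velocity B K v1 v2"
    and bar: "pbar = to_glue Pf S pK" "vbar = to_glue Pf S vK"
    and d: "dp \<in> carrier_vec m" "dv \<in> carrier_vec m"
    and star: "pstar \<in> carrier_vec (edge_size B K)" "vstar \<in> carrier_vec (edge_size B K)"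
    and jump: "pstar - pK = grid_jump S Pg dp pbar pK" "vstar - vK = grid_jump S Pg dv vbar vK"
  shows "dissipation_rate B K v1 v2 p pstar vstar
       = - (vbar \<bullet> (M *\<^sub>v dp)) - pbar \<bullet> (M *\<^sub>v dv) - vbar \<bullet> (M *\<^sub>v pbar)"
proof -
  define n where "n = edge_size B K"
  define s where "s = (\<lambda>k. surface_jacobian B K (edge_grid_point B K k))"
  define H where "H = edge_norm_mat B K"
  define A where "A = H * mat_diag n s"
  have S': "S = mat_diag n s"
    by (simp add: S surface_jacobian_mat_def n_def s_def)
  have s: "\<forall>k<n. 0 < s k"
    using B by (simp add: s_def n_def surface_jacobian_pos edge_grid_point_in_ref_square)
  have H: "H \<in> carrier_mat n n" "diagonal_mat H"
    using B by (auto simp: H_def n_def edge_norm_mat_def edge_size_def sbp_block_def sbp_operator_def)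
  have A: "A \<in> carrier_mat n n"
    using H by (simp add: A_def)
  have p: "pK \<in> carrier_vec n" and v: "vK \<in> carrier_vec n"
    by (simp_all add: w n_def edge_restrict_carrier edge_normal_velocity_carrier)
  note pstar = star(1)[folded n_def] and vstar = star(2)[folded n_def]
  note compat = compat[folded n_def H_def]
  note b = to_glue_carrier[OF compat, of S]
  have A_commute: "x \<bullet> (A *\<^sub>v y) = y \<bullet> (A *\<^sub>v x)"
    if "x \<in> carrier_vec n" "y \<in> carrier_vec n" for x y
    using that by (simp add: scalar_prod_norm_surface[OF H, of _ _ s, folded A_def] mult_ac)
  have minus: "x \<bullet> (A *\<^sub>v (y - z)) = x \<bullet> (A *\<^sub>v y) - x \<bullet> (A *\<^sub>v z)"
    if "x \<in> carrier_vec n" "y \<in> carrier_vec n" "z \<in> carrier_vec n" for x y z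
    using that A by (simp add: mult_minus_distrib_mat_vec[OF A] scalar_prod_minus_distrib[of _ n]
        mult_mat_vec_carrier[of _ n n])
  have jump_form: "x \<bullet> (A *\<^sub>v grid_jump S Pg c e y)
      = to_glue Pf S x \<bullet> (M *\<^sub>v c) + (1/2) * (to_glue Pf S x \<bullet> (M *\<^sub>v e)) - (1/2) * (x \<bullet> (A *\<^sub>v y))"
    if "x \<in> carrier_vec n" "y \<in> carrier_vec n" "c \<in> carrier_vec m" "e \<in> carrier_vec m" for x y c e
    using scalar_prod_norm_surface_grid_jump[OF H s M compat, folded A_def S'] that by simp
  have A_eq: "edge_norm_mat B K * surface_jacobian_mat B K = A"
    by (simp only: A_def H_def S'[symmetric] S)
  have "dissipation_rate B K v1 v2 p pstar vstar
      = - (vK \<bullet> (A *\<^sub>v pstar)) + vK \<bullet> (A *\<^sub>v pK) - pK \<bullet> (A *\<^sub>v vstar)"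
    by (simp only: dissipation_rate_def Let_def A_eq w[symmetric] A_commute[OF vstar p])
  \<comment> \<open>The pressure jump absorbs the positive term in \<open>pK\<close>. Expanding
    \<open>vstar\<close> around \<open>vK\<close> creates a negative one, by symmetry of
    \<open>A\<close>.\<close>
  also have "\<dots> = - (vK \<bullet> (A *\<^sub>v (pstar - pK))) - pK \<bullet> (A *\<^sub>v (vstar - vK)) - vK \<bullet> (A *\<^sub>v pK)"
    using A_commute[OF v p] by (simp add: minus p v pstar vstar)
  also have "\<dots> = - (vbar \<bullet> (M *\<^sub>v dp)) - pbar \<bullet> (M *\<^sub>v dv)
      - (1/2) * (vbar \<bullet> (M *\<^sub>v pbar)) - (1/2) * (pbar \<bullet> (M *\<^sub>v vbar))"
    using A_commute[OF v p] unfolding jump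
    by (simp add: jump_form p v d bar b)
  \<comment> \<open>Symmetry of \<open>M\<close> merges the two halves into the single term
    \<open>vbar \<bullet> (M *\<^sub>v pbar)\<close>.\<close>
  also have "pbar \<bullet> (M *\<^sub>v vbar) = vbar \<bullet> (M *\<^sub>v pbar)"
    unfolding bar by (intro scalar_prod_mult_mat_vec_commute[OF M] b)
  finally show ?thesis
    by simp
qed

theorem theorem4p1:
  fixes Bm Bp :: sbp_block_data
    and Km Kp :: edge
    and v1m v2m pm v1p v2p pp :: "real vec"
    and m :: nat
    and \<psi> :: "nat \<Rightarrow> real \<Rightarrow> real"
    and M Sm Sp Pf2gm Pg2fm Pf2gp Pg2fp :: "real mat"
    and pKm vKm pKp vKp :: "real vec"
    and pbarm vbarm pbarp vbarp :: "real vec"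
    and pstarm vstarm pstarp vstarp :: "real vec"
    and \<rho> lam Z \<alpha> :: real
  assumes "\<rho> > 0" and "lam > 0" and "Z = sqrt (\<rho> / lam)"
    and "sbp_block Bm" and "sbp_block Bp"
    and "block_interface Bm Km Bp Kp"
    and "v1m \<in> carrier_vec (block_size Bm)" and "v2m \<in> carrier_vec (block_size Bm)"
    and "pm \<in> carrier_vec (block_size Bm)"
    and "v1p \<in> carrier_vec (block_size Bp)" and "v2p \<in> carrier_vec (block_size Bp)"
    and "pp \<in> carrier_vec (block_size Bp)"
    and "pKm = edge_restrict Bm Km pm" and "vKm = edge_normal_velocity Bm Km v1m v2m"
    and "pKp = edge_restrict Bp Kp pp" and "vKp = edge_normal_velocity Bp Kp v1p v2p"
    and "Sm = surface_jacobian_mat Bm Km" and "Sp = surface_jacobian_mat Bp Kp"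
    and "glue_basis m \<psi>" and "M = glue_mass_mat m \<psi>"
    and "norm_compatible m (edge_size Bm Km) M (edge_norm_mat Bm Km) Pf2gm Pg2fm"
    and "norm_compatible m (edge_size Bp Kp) M (edge_norm_mat Bp Kp) Pf2gp Pg2fp"
    and "pbarm = to_glue Pf2gm Sm pKm" and "vbarm = to_glue Pf2gm Sm vKm"
    and "pbarp = to_glue Pf2gp Sp pKp" and "vbarp = to_glue Pf2gp Sp vKp"
    and "pstarm \<in> carrier_vec (edge_size Bm Km)" and "vstarm \<in> carrier_vec (edge_size Bm Km)"
    and "pstarp \<in> carrier_vec (edge_size Bp Kp)" and "vstarp \<in> carrier_vec (edge_size Bp Kp)"
    and "pstarm - pKm =
           grid_jump Sm Pg2fm (glue_jump_p \<alpha> Z pbarm vbarm pbarp vbarp) pbarm pKm"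
    and "vstarm - vKm =
           grid_jump Sm Pg2fm (glue_jump_v \<alpha> Z pbarm vbarm pbarp vbarp) vbarm vKm"
    and "pstarp - pKp =
           grid_jump Sp Pg2fp (glue_jump_p \<alpha> Z pbarp vbarp pbarm vbarm) pbarp pKp"
    and "vstarp - vKp =
           grid_jump Sp Pg2fp (glue_jump_v \<alpha> Z pbarp vbarp pbarm vbarm) vbarp vKp"
  shows "dissipation_rate Bm Km v1m v2m pm pstarm vstarm
           + dissipation_rate Bp Kp v1p v2p pp pstarp vstarp
         = - (\<alpha> * (Z / 2)) * scalar_prod (vbarm + vbarp) (M *\<^sub>v (vbarm + vbarp))
           - \<alpha> * (1 / (2 * Z)) * scalar_prod (pbarm - pbarp) (M *\<^sub>v (pbarm - pbarp))
       \<and> (\<alpha> \<ge> 0 \<longrightarrow>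
            dissipation_rate Bm Km v1m v2m pm pstarm vstarm
              + dissipation_rate Bp Kp v1p v2p pp pstarp vstarp \<le> 0)"
proof -
  have M: "M \<in> carrier_mat m m" "transpose_mat M = M"
    using \<open>M = glue_mass_mat m \<psi>\<close> by (simp_all add: transpose_glue_mass_mat)
  note compat_m = \<open>norm_compatible m (edge_size Bm Km) M (edge_norm_mat Bm Km) Pf2gm Pg2fm\<close>
    and compat_p = \<open>norm_compatible m (edge_size Bp Kp) M (edge_norm_mat Bp Kp) Pf2gp Pg2fp\<close>
  have bars: "pbarm \<in> carrier_vec m" "vbarm \<in> carrier_vec m" "pbarp \<in> carrier_vec m"
    "vbarp \<in> carrier_vec m"
    using assms(23-26) by (simp_all add: to_glue_carrier[OF compat_m] to_glue_carrier[OF compat_p])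
  have rate_m: "dissipation_rate Bm Km v1m v2m pm pstarm vstarm
      = - (vbarm \<bullet> (M *\<^sub>v glue_jump_p \<alpha> Z pbarm vbarm pbarp vbarp))
        - pbarm \<bullet> (M *\<^sub>v glue_jump_v \<alpha> Z pbarm vbarm pbarp vbarp) - vbarm \<bullet> (M *\<^sub>v pbarm)"
    using assms bars by (intro dissipation_rate_glue[OF _ M compat_m]) (simp_all add: glue_jump_carrier)
  have rate_p: "dissipation_rate Bp Kp v1p v2p pp pstarp vstarp
      = - (vbarp \<bullet> (M *\<^sub>v glue_jump_p \<alpha> Z pbarp vbarp pbarm vbarm))
        - pbarp \<bullet> (M *\<^sub>v glue_jump_v \<alpha> Z pbarp vbarp pbarm vbarm) - vbarp \<bullet> (M *\<^sub>v pbarp)"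
    using assms bars by (intro dissipation_rate_glue[OF _ M compat_p]) (simp_all add: glue_jump_carrier)
  have eq: "dissipation_rate Bm Km v1m v2m pm pstarm vstarm
        + dissipation_rate Bp Kp v1p v2p pp pstarp vstarp
      = - (\<alpha> * (Z / 2)) * ((vbarm + vbarp) \<bullet> (M *\<^sub>v (vbarm + vbarp)))
        - \<alpha> * (1 / (2 * Z)) * ((pbarm - pbarp) \<bullet> (M *\<^sub>v (pbarm - pbarp)))"
    \<comment> \<open>The plus-side rate is the minus-side rate with the roles exchanged, which is
      the shape of the identity for \<open>M\<close>.\<close>
    unfolding rate_m rate_p by (rule glue_jumps_identity[OF M bars])
  have nonneg: "0 \<le> (vbarm + vbarp) \<bullet> (M *\<^sub>v (vbarm + vbarp))"
    "0 \<le> (pbarm - pbarp) \<bullet> (M *\<^sub>v (pbarm - pbarp))"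
    using bars \<open>glue_basis m \<psi>\<close> \<open>M = glue_mass_mat m \<psi>\<close> by (simp_all add: glue_mass_mat_nonneg)
  have "0 \<le> Z"
    using assms(1-3) by simp
  then have "0 \<le> \<alpha> * (Z / 2) * ((vbarm + vbarp) \<bullet> (M *\<^sub>v (vbarm + vbarp)))"
    "0 \<le> \<alpha> * (1 / (2 * Z)) * ((pbarm - pbarp) \<bullet> (M *\<^sub>v (pbarm - pbarp)))" if "\<alpha> \<ge> 0"
    using that nonneg by (intro mult_nonneg_nonneg; simp)+
  with eq show ?thesis
    by auto
qed

end
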